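(* Let $(\gamma_s,v_1,v_2)$ and $(\tilde\gamma_s,\tilde v_1,\tilde v_2)$ be two pseudo-spherical spacelike framed curves $I\to AdS^3\times\Delta_1$, where $I\subset\mathbb{R}$ is an interval. Suppose that the curvatures $(\alpha,\ell,m,n)$ and $(\tilde\alpha,\tilde\ell,\tilde m,\tilde n)$ of these two framed curves coincide. Then $(\gamma_s,v_1,v_2)$ and $(\tilde\gamma_s,\tilde v_1,\tilde v_2)$ are congruent as pseudo-spherical spacelike framed curves: there is a matrix $A\in SO(2,2)$ such that $\tilde\gamma_s(s)=A\gamma_s(s)$, $\tilde v_1(s)=Av_1(s)$ and $\tilde v_2(s)=Av_2(s)$ for all $s\in I$.
   Context: $\mathbb{R}^4_2$ is $\mathbb{R}^4$ with $\langle u,w\rangle=-u_1w_1-u_2w_2+u_3w_3+u_4w_4$; the triple product $u\times v\times w$ is the unique vector with $\langle x,u\times v\times w\rangle=\det(x,u,v,w)$ for all $x$. $SO(2,2)$ is the group of determinant-one real $4\times4$ matrices preserving $\langle\cdot,\cdot\rangle$. $AdS^3=\{u:\langle u,u\rangle=-1\}$, $S^3_2=\{u:\langle u,u\rangle=1\}$, and $\Delta_1=\{(u,w):\langle u,w\rangle=0\}\subset AdS^3\times S^3_2$ (or $\subset S^3_2\times AdS^3$). A pseudo-spherical spacelike framed curve is a smooth map $(\gamma_s,v_1,v_2):I\to AdS^3\times\Delta_1$ with $\langle\gamma_s,v_i\rangle=0$ and $\langle\gamma_s',v_i\rangle=0$ on $I$ for $i=1,2$ (so one of $v_1,v_2$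 is in $S^3_2$, the other in $AdS^3$). Put $\mu=\gamma_s\times v_1\times v_2$ and $\epsilon=\langle v_1,v_1\rangle\in\{\pm1\}$. The curvature of $(\gamma_s,v_1,v_2)$ is $(\alpha,\ell,m,n)$ with $\alpha=\langle\gamma_s',\mu\rangle$, $\ell=-\epsilon\langle v_1',v_2\rangle$, $m=\langle v_1',\mu\rangle$, $n=\langle v_2',\mu\rangle$; equivalently $\gamma_s'=\alpha\mu$, $v_1'=\ell v_2+m\mu$, $v_2'=\ell v_1+n\mu$, $\mu'=\alpha\gamma_s-\epsilon m v_1+\epsilon n v_2$. *)

theory Defs
  imports "HOL-Analysis.Analysis"
begin

definition pinner :: "real^4 \<Rightarrow> real^4 \<Rightarrow> real" where
  "pinner u w = - (u$1 * w$1) - u$2 * w$2 + u$3 * w$3 + u$4 * w$4"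

(* The vectors are the rows of the matrix; its determinant is the same as with columns. *)
definition triple_product :: "real^4 \<Rightarrow> real^4 \<Rightarrow> real^4 \<Rightarrow> real^4" where
  "triple_product u v w = (THE p. \<forall>x. pinner x p = det (vector [x, u, v, w] :: real^4^4))"

lemma vector_4_nth:
  "(vector [a, b, c, d] :: 'a::zero^4) $ 1 = a" "(vector [a, b, c, d] :: 'a::zero^4) $ 2 = b"
  "(vector [a, b, c, d] :: 'a::zero^4) $ 3 = c" "(vector [a, b, c, d] :: 'a::zero^4) $ 4 = d"
  unfolding vector_def by simp_all

lemma pinner_nondegenerate:
  assumes "\<And>x. pinner x p = pinner x q"
  shows "p = q"
  using assms[of "axis 1 1"] assms[of "axis 2 1"] assms[of "axis 3 1"] assms[of "axis 4 1"]
  by (simp add: vec_eq_iff forall_4 pinner_def axis_def)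

lemma triple_product_ex1:
  "\<exists>!p. \<forall>x. pinner x p = det (vector [x, u, v, w] :: real^4^4)"
proof -
  define b :: "4 \<Rightarrow> real^4" where "b = (\<lambda>i. (vector [0, u, v, w] :: real^4^4) $ i)"
  define f where "f x = det (\<chi> i. if i = 1 then x else b i)" for x :: "real^4"
  have f: "f x = det (vector [x, u, v, w] :: real^4^4)" for x
    unfolding f_def b_def
    by (rule arg_cong[of _ _ det]) (simp add: vec_eq_iff[where ?'b = 4] forall_4 vector_4_nth)
  have "linear f"
  proof (rule linearI)
    show "f (x + y) = f x + f y" for x y
      using det_row_add[of 1 "\<lambda>_. x" "\<lambda>_. y" b] by (simp add: f_def)
    show "f (c *\<^sub>R x) = c *\<^sub>R f x" for c x
      using det_row_mul[of 1 c "\<lambda>_. x" b] by (simp add: f_def scalar_mult_eq_scaleR cong: if_cong)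
  qed
  then have "x \<bullet> adjoint f 1 = f x" for x
    using adjoint_works[of f x 1] by simp
  then have "pinner x (\<chi> i. if i = 1 \<or> i = 2 then - adjoint f 1 $ i else adjoint f 1 $ i) = f x" for x
    by (simp add: pinner_def inner_vec_def sum_4 flip: \<open>\<And>x. x \<bullet> adjoint f 1 = f x\<close>)
  then show ?thesis
    by (metis (no_types, lifting) f pinner_nondegenerate)
qed

lemma pinner_triple_product:
  "pinner x (triple_product u v w) = det (vector [x, u, v, w] :: real^4^4)"
  using theI'[OF triple_product_ex1[of u v w]] unfolding triple_product_def by blast

definition SO22 :: "(real^4^4) set" where
  "SO22 = {A. det A = 1 \<and> (\<forall>u w. pinner (A *v u) (A *v w) = pinner u w)}"

definition AdS3 :: "(real^4) set" where
  "AdS3 = {u. pinner u u = -1}"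

definition S32 :: "(real^4) set" where
  "S32 = {u. pinner u u = 1}"

definition pseudo_orthogonal_pairs :: "(real^4) set \<Rightarrow> (real^4) set \<Rightarrow> ((real^4) \<times> (real^4)) set" where
  "pseudo_orthogonal_pairs X Y = {(u, w). u \<in> X \<and> w \<in> Y \<and> pinner u w = 0}"

(* The two possible meanings of the symbol Delta_1. *)
definition Delta1_variants :: "((real^4) \<times> (real^4)) set set" where
  "Delta1_variants = {pseudo_orthogonal_pairs AdS3 S32, pseudo_orthogonal_pairs S32 AdS3}"

(* Smoothness is C-infinity on I, with one-sided derivatives at the endpoints that belong to I.
   D k is the k-th derivative of f. *)
definition smooth_curve_on :: "real set \<Rightarrow> (real \<Rightarrow> 'a::real_normed_vector) \<Rightarrow> bool" where
  "smooth_curve_on I f \<longleftrightarrow>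
     (\<exists>D :: nat \<Rightarrow> real \<Rightarrow> 'a. (\<forall>s\<in>I. D 0 s = f s) \<and>
        (\<forall>k. \<forall>s\<in>I. (D k has_vector_derivative D (Suc k) s) (at s within I)))"

abbreviation deriv_on :: "real set \<Rightarrow> (real \<Rightarrow> 'a::real_normed_vector) \<Rightarrow> real \<Rightarrow> 'a" where
  "deriv_on I f s \<equiv> vector_derivative f (at s within I)"

definition spacelike_framed_curve ::
  "((real^4) \<times> (real^4)) set \<Rightarrow> real set \<Rightarrow>
     (real \<Rightarrow> real^4) \<Rightarrow> (real \<Rightarrow> real^4) \<Rightarrow> (real \<Rightarrow> real^4) \<Rightarrow> bool" where
  "spacelike_framed_curve \<Delta> I \<gamma> v1 v2 \<longleftrightarrow>
     \<Delta> \<in> Delta1_variants \<and>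
     smooth_curve_on I (\<lambda>s. (\<gamma> s, v1 s, v2 s)) \<and>
     (\<forall>s\<in>I. (\<gamma> s, v1 s, v2 s) \<in> AdS3 \<times> \<Delta>) \<and>
     (\<forall>s\<in>I. pinner (\<gamma> s) (v1 s) = 0 \<and> pinner (\<gamma> s) (v2 s) = 0) \<and>
     (\<forall>s\<in>I. pinner (deriv_on I \<gamma> s) (v1 s) = 0 \<and> pinner (deriv_on I \<gamma> s) (v2 s) = 0)"

definition framed_curvature ::
  "real set \<Rightarrow> (real \<Rightarrow> real^4) \<Rightarrow> (real \<Rightarrow> real^4) \<Rightarrow> (real \<Rightarrow> real^4) \<Rightarrow>
     real \<Rightarrow> real \<times> real \<times> real \<times> real" where
  "framed_curvature I \<gamma> v1 v2 s =
     (let \<mu> = triple_product (\<gamma> s) (v1 s) (v2 s);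
          \<epsilon> = pinner (v1 s) (v1 s)
      in (pinner (deriv_on I \<gamma> s) \<mu>,
          - \<epsilon> * pinner (deriv_on I v1 s) (v2 s),
          pinner (deriv_on I v1 s) \<mu>,
          pinner (deriv_on I v2 s) \<mu>))"

end

theory Submission
  imports Defs
begin

text \<open>Both framed curves, completed by the triple products of their members, are pseudo-orthonormal
  frames with the same signature and determinant one, so for each \<open>s\<close> a unique linear map
  \<open>\<Phi> s\<close> takes the first frame at \<open>s\<close> to the second, and it lies in
  \<open>SO(2,2)\<close>. In \<open>\<Phi> s x = \<Sum>i. d i * \<langle>x, e i s\<rangle> * e' i s\<close> (with signs
  \<open>d i\<close>) both frames satisfy the same Frenet equations, whose coefficient matrix is skew with
  respect to these signs; hence the \<open>s\<close>-derivative cancels and \<open>\<Phi>\<close> is constant, with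
  no appeal to uniqueness for differential equations.\<close>

section \<open>Determinants, the triple product and the bilinear form\<close>

lemma det_4:
  "det (A :: 'a::comm_ring_1^4^4) =
    A$1$1 * (A$2$2 * (A$3$3 * A$4$4 - A$3$4 * A$4$3) - A$2$3 * (A$3$2 * A$4$4 - A$3$4 * A$4$2)
      + A$2$4 * (A$3$2 * A$4$3 - A$3$3 * A$4$2))
  - A$1$2 * (A$2$1 * (A$3$3 * A$4$4 - A$3$4 * A$4$3) - A$2$3 * (A$3$1 * A$4$4 - A$3$4 * A$4$1)
      + A$2$4 * (A$3$1 * A$4$3 - A$3$3 * A$4$1))
  + A$1$3 * (A$2$1 * (A$3$2 * A$4$4 - A$3$4 * A$4$2) - A$2$2 * (A$3$1 * A$4$4 - A$3$4 * A$4$1)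
      + A$2$4 * (A$3$1 * A$4$2 - A$3$2 * A$4$1))
  - A$1$4 * (A$2$1 * (A$3$2 * A$4$3 - A$3$3 * A$4$2) - A$2$2 * (A$3$1 * A$4$3 - A$3$3 * A$4$1)
      + A$2$3 * (A$3$1 * A$4$2 - A$3$2 * A$4$1))"
proof -
  \<comment> \<open>Side conditions for peeling off the indices 1, 2 and 3 in turn, which leaves
    only the permutations of {4}.\<close>
  have f: "finite {2::4, 3, 4}" "1 \<notin> {2::4, 3, 4}"
    "finite {3::4, 4}" "2 \<notin> {3::4, 4}" "finite {4::4}" "3 \<notin> {4::4}"
    by auto
  show ?thesis
    unfolding det_def UNIV_4
    unfolding sum_over_permutations_insert[OF f(1,2)]
    unfolding sum_over_permutations_insert[OF f(3,4)]
    unfolding sum_over_permutations_insert[OF f(5,6)]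
    unfolding permutes_sing
    by (simp add: sign_swap_id permutation_swap_id sign_compose sign_id permutation_compose
        swap_id_eq transpose_def algebra_simps)
qed

lemma triple_product_nth:
  "triple_product u v w $ 1 = - det (vector [axis 1 1, u, v, w] :: real^4^4)"
  "triple_product u v w $ 2 = - det (vector [axis 2 1, u, v, w] :: real^4^4)"
  "triple_product u v w $ 3 = det (vector [axis 3 1, u, v, w] :: real^4^4)"
  "triple_product u v w $ 4 = det (vector [axis 4 1, u, v, w] :: real^4^4)"
  unfolding pinner_triple_product[symmetric] by (simp_all add: pinner_def axis_def)

text \<open>A Lagrange-type identity: the triple product is orthogonal to its arguments, and the
  form has determinant 1, so no extra sign appears. It is checked as a polynomial identity in
  coordinates.\<close>

lemma pinner_triple_product_self:
  "pinner (triple_product u v w) (triple_product u v w) =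
    det (vector [vector [pinner u u, pinner u v, pinner u w],
                 vector [pinner v u, pinner v v, pinner v w],
                 vector [pinner w u, pinner w v, pinner w w]] :: real^3^3)"
  unfolding pinner_triple_product det_3 vector_3
  by (simp add: det_4 vector_4_nth triple_product_nth axis_def pinner_def) algebra

lemma bounded_bilinear_pinner: "bounded_bilinear pinner"
proof -
  define J :: "real^4 \<Rightarrow> real^4" where "J x = (\<chi> i. if i = 1 \<or> i = 2 then - x $ i else x $ i)" for x
  have "linear J"
    by (rule linearI) (auto simp: J_def vec_eq_iff)
  then have "bounded_linear J"
    by (simp add: linear_conv_bounded_linear)
  moreover have "pinner = (\<lambda>x y. x \<bullet> J y)"
    by (auto simp: fun_eq_iff pinner_def J_def inner_vec_def sum_4)
  ultimately show ?thesis
    using bounded_bilinear.comp[OF bounded_bilinear_inner bounded_linear_ident] by metis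
qed

interpretation pinner: bounded_bilinear pinner
  by (rule bounded_bilinear_pinner)

lemma pinner_commute: "pinner x y = pinner y x"
  by (simp add: pinner_def)

text \<open>Each pairing is a determinant with a repeated row.\<close>

lemma triple_product_orthogonal:
  "pinner u (triple_product u v w) = 0"
  "pinner v (triple_product u v w) = 0"
  "pinner w (triple_product u v w) = 0"
  unfolding pinner_triple_product
  by (simp_all add: det_4 vector_4_nth algebra_simps)

text \<open>By \<open>triple_product_nth\<close> the coordinates are polynomials in those of the
  arguments. This is how \<mu> inherits differentiability from the framed curve.\<close>

lemma differentiable_triple_product:
  fixes u v w :: "real \<Rightarrow> real^4"
  assumes "u differentiable at t within S" "v differentiable at t within S"
    and "w differentiable at t within S"
  shows "(\<lambda>s. triple_product (u s) (v s) (w s)) differentiable at t within S"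
proof -
  have nth: "(\<lambda>s. f s $ i) differentiable at t within S"
    if "f differentiable at t within S" for f :: "real \<Rightarrow> real^4" and i
    using differentiable_compose[OF bounded_linear_imp_differentiable[OF bounded_linear_vec_nth] that]
    by simp
  have "\<forall>i. (\<lambda>s. triple_product (u s) (v s) (w s) $ i) differentiable at t within S"
    unfolding forall_4 triple_product_nth det_4 vector_4_nth
    by (intro conjI derivative_intros nth assms)
  then show ?thesis
    by (subst differentiable_componentwise_within) (auto simp: Basis_vec_def inner_axis)
qed

section \<open>Pseudo-orthonormal frames and the linear maps between them\<close>

definition pseudo_frame :: "real \<Rightarrow> real^4 \<Rightarrow> real^4 \<Rightarrow> real^4 \<Rightarrow> bool" where
  "pseudo_frame \<epsilon> u v w \<longleftrightarrow> \<epsilon> * \<epsilon> = 1 \<and>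
     pinner u u = -1 \<and> pinner v v = \<epsilon> \<and> pinner w w = - \<epsilon> \<and>
     pinner u v = 0 \<and> pinner u w = 0 \<and> pinner v w = 0"

text \<open>The Gram determinant of \<open>u\<close>, \<open>v\<close>, \<open>w\<close> is (-1) *
  \<epsilon> * (-\<epsilon>) = 1, whence the norm of the triple product. Mixed products are listed
  in both orders for direct rewriting.\<close>

lemma pseudo_frame_pinner:
  assumes "pseudo_frame \<epsilon> u v w"
  shows "\<epsilon> * \<epsilon> = 1" "pinner u u = -1" "pinner v v = \<epsilon>" "pinner w w = - \<epsilon>"
    "pinner u v = 0" "pinner v u = 0" "pinner u w = 0" "pinner w u = 0"
    "pinner v w = 0" "pinner w v = 0"
    "pinner (triple_product u v w) (triple_product u v w) = 1"
    "pinner u (triple_product u v w) = 0" "pinner (triple_product u v w) u = 0"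
    "pinner v (triple_product u v w) = 0" "pinner (triple_product u v w) v = 0"
    "pinner w (triple_product u v w) = 0" "pinner (triple_product u v w) w = 0"
  using assms
  by (auto simp: pseudo_frame_def pinner_commute triple_product_orthogonal
      pinner_triple_product_self det_3)

text \<open>The defining property of the triple product, applied to the triple product itself, turns
  this determinant into its squared norm.\<close>

lemma det_pseudo_frame:
  assumes "pseudo_frame \<epsilon> u v w"
  shows "det (vector [triple_product u v w, u, v, w] :: real^4^4) = 1"
  using pseudo_frame_pinner(11)[OF assms] by (simp add: pinner_triple_product)

lemma pseudo_frame_eqI:
  assumes fr: "pseudo_frame \<epsilon> u v w"
    and "pinner x (triple_product u v w) = pinner y (triple_product u v w)"
    and "pinner x u = pinner y u" "pinner x v = pinner y v" "pinner x w = pinner y w"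
  shows "x = y"
proof -
  let ?M = "vector [triple_product u v w, u, v, w] :: real^4^4"
  \<comment> \<open>\<open>J\<close> absorbs the signs of the form, so that \<open>?M *v J z\<close>
    lists the pairings of \<open>z\<close> with the frame; \<open>?M\<close> is invertible, having
    determinant one.\<close>
  define J :: "real^4 \<Rightarrow> real^4" where "J z = (\<chi> i. if i = 1 \<or> i = 2 then - z $ i else z $ i)" for z
  have "?M *v J z = vector [pinner z (triple_product u v w), pinner z u, pinner z v, pinner z w]" for z
    by (simp add: vec_eq_iff[where ?'b = 4] forall_4 vector_4_nth matrix_vector_mult_def sum_4
        J_def pinner_def algebra_simps)
  then have "?M *v J x = ?M *v J y"
    using assms by simp
  moreover have "inj ((*v) ?M)"
    using det_pseudo_frame[OF fr] by (simp add: inj_matrix_vector_mult invertible_det_nz)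
  ultimately have "J x = J y"
    by (simp add: inj_eq)
  then show "x = y"
    by (auto simp: vec_eq_iff forall_4 J_def)
qed

text \<open>Both sides pair equally with the frame. The signs are the inverses of the squared norms
  1, -1, \<epsilon>, -\<epsilon>, where 1/\<epsilon> = \<epsilon>.\<close>

lemma pseudo_frame_expansion:
  assumes fr: "pseudo_frame \<epsilon> u v w"
  defines "\<mu> \<equiv> triple_product u v w"
  shows "x = pinner x \<mu> *\<^sub>R \<mu> - pinner x u *\<^sub>R u + (\<epsilon> * pinner x v) *\<^sub>R v - (\<epsilon> * pinner x w) *\<^sub>R w"
  using pseudo_frame_pinner[OF fr]
  by (intro pseudo_frame_eqI[OF fr]) (simp_all add: \<mu>_def pinner.add_left pinner.diff_left pinner.scaleR_left)

text \<open>This is the expansion of \<open>x\<close> in the first frame, with the frame vectors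
  replaced by those of the second.\<close>

definition frame_map ::
  "real \<Rightarrow> real^4 \<Rightarrow> real^4 \<Rightarrow> real^4 \<Rightarrow> real^4 \<Rightarrow> real^4 \<Rightarrow> real^4 \<Rightarrow> real^4 \<Rightarrow> real^4" where
  "frame_map \<epsilon> u v w u' v' w' x =
     pinner x (triple_product u v w) *\<^sub>R triple_product u' v' w'
     - pinner x u *\<^sub>R u' + (\<epsilon> * pinner x v) *\<^sub>R v' - (\<epsilon> * pinner x w) *\<^sub>R w'"

lemma linear_frame_map: "linear (frame_map \<epsilon> u v w u' v' w')"
  by (rule linearI) (simp_all add: frame_map_def pinner.add_left pinner.scaleR_left algebra_simps)

lemma frame_map_frame:
  assumes "pseudo_frame \<epsilon> u v w"
  shows "frame_map \<epsilon> u v w u' v' w' u = u'" "frame_map \<epsilon> u v w u' v' w' v = v'"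
    "frame_map \<epsilon> u v w u' v' w' w = w'"
    "frame_map \<epsilon> u v w u' v' w' (triple_product u v w) = triple_product u' v' w'"
  using pseudo_frame_pinner[OF assms] by (simp_all add: frame_map_def)

lemma matrix_frame_map_in_SO22:
  assumes fr: "pseudo_frame \<epsilon> u v w" and fr': "pseudo_frame \<epsilon> u' v' w'"
  shows "matrix (frame_map \<epsilon> u v w u' v' w') \<in> SO22"
proof -
  let ?f = "frame_map \<epsilon> u v w u' v' w'"
  let ?A = "matrix ?f"
  have A: "?A *v x = ?f x" for x
    by (simp add: linear_frame_map matrix_works)
  have "pinner (?f x) (?f y) = pinner x y" for x y
  proof -
    \<comment> \<open>Orthonormality of the primed frame leaves only products of coefficients;
      regrouped, they pair \<open>x\<close> with the expansion of \<open>y\<close> in the unprimed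
      frame.\<close>
    have "pinner (?f x) (?f y) = pinner x (pinner y (triple_product u v w) *\<^sub>R triple_product u v w
        - pinner y u *\<^sub>R u + (\<epsilon> * pinner y v) *\<^sub>R v - (\<epsilon> * pinner y w) *\<^sub>R w)"
      using pseudo_frame_pinner[OF fr']
      by (simp add: frame_map_def pinner.add_left pinner.diff_left pinner.scaleR_left
          pinner.add_right pinner.diff_right pinner.scaleR_right) algebra
    then show ?thesis
      using pseudo_frame_expansion[OF fr, of y] by simp
  qed
  moreover have "det ?A = 1"
  proof -
    let ?M = "\<lambda>u v w. vector [triple_product u v w, u, v, w] :: real^4^4"
    \<comment> \<open>The frames are stored as rows, so \<open>?A\<close> acts on them through right
      multiplication by its transpose.\<close>
    have row: "(M ** transpose ?A) $ i = ?A *v (M $ i)" for M :: "real^4^4" and i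
      by (simp add: vec_eq_iff matrix_matrix_mult_def matrix_vector_mult_def transpose_def mult.commute)
    have "?M u v w ** transpose ?A = ?M u' v' w'"
      by (subst vec_eq_iff[where ?'b = 4])
        (simp add: row A forall_4 vector_4_nth frame_map_frame[OF fr])
    then have "det (?M u v w) * det ?A = det (?M u' v' w')"
      by (metis det_mul det_transpose)
    then show ?thesis
      using det_pseudo_frame[OF fr] det_pseudo_frame[OF fr'] by simp
  qed
  ultimately show ?thesis
    by (simp add: SO22_def A)
qed

section \<open>Frenet equations of a framed curve\<close>

lemma spacelike_framed_curve_pseudo_frame:
  assumes "spacelike_framed_curve \<Delta> I \<gamma> v1 v2" "s \<in> I"
  shows "pseudo_frame (if \<Delta> = pseudo_orthogonal_pairs AdS3 S32 then -1 else 1) (\<gamma> s) (v1 s) (v2 s)"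
  using assms
  by (auto simp: spacelike_framed_curve_def Delta1_variants_def pseudo_frame_def
      pseudo_orthogonal_pairs_def AdS3_def S32_def)

text \<open>The product rule is compared with the zero derivative of a constant; the nontrivial
  filter makes the derivative unique.\<close>

lemma pinner_derivative_constant:
  assumes "\<And>s. s \<in> I \<Longrightarrow> pinner (f s) (g s) = c" "t \<in> I" "at t within I \<noteq> bot"
    and "(f has_vector_derivative f') (at t within I)" "(g has_vector_derivative g') (at t within I)"
  shows "pinner f' (g t) = - pinner (f t) g'"
proof -
  have "((\<lambda>s. pinner (f s) (g s)) has_vector_derivative pinner (f t) g' + pinner f' (g t)) (at t within I)"
    by (rule pinner.has_vector_derivative[OF assms(4,5)])
  moreover have "((\<lambda>s. pinner (f s) (g s)) has_vector_derivative 0) (at t within I)"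
    by (rule has_vector_derivative_transform[OF assms(2) assms(1) has_vector_derivative_const])
  ultimately have "pinner (f t) g' + pinner f' (g t) = 0"
    by (rule vector_derivative_unique_within[OF assms(3)])
  then show ?thesis by simp
qed

text \<open>By \<open>pseudo_frame_eqI\<close> it suffices to compare pairings with the frame. These
  come from the curvature, the orthogonality of \<open>deriv_on I \<gamma> t\<close> to
  \<open>v1 t\<close> and \<open>v2 t\<close>, and skew-symmetry.\<close>

lemma frenet_equations:
  assumes curve: "spacelike_framed_curve \<Delta> I \<gamma> v1 v2" and t: "t \<in> I"
    and nontriv: "at t within I \<noteq> bot"
    and curv: "framed_curvature I \<gamma> v1 v2 t = (\<alpha>, l, m, n)"
  defines "\<mu> \<equiv> \<lambda>s. triple_product (\<gamma> s) (v1 s) (v2 s)"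
    and "\<epsilon> \<equiv> if \<Delta> = pseudo_orthogonal_pairs AdS3 S32 then -1 else 1 :: real"
  shows "(\<gamma> has_vector_derivative \<alpha> *\<^sub>R \<mu> t) (at t within I)"
    and "(v1 has_vector_derivative l *\<^sub>R v2 t + m *\<^sub>R \<mu> t) (at t within I)"
    and "(v2 has_vector_derivative l *\<^sub>R v1 t + n *\<^sub>R \<mu> t) (at t within I)"
    and "(\<mu> has_vector_derivative \<alpha> *\<^sub>R \<gamma> t - (\<epsilon> * m) *\<^sub>R v1 t + (\<epsilon> * n) *\<^sub>R v2 t) (at t within I)"
proof -
  have fr: "pseudo_frame \<epsilon> (\<gamma> s) (v1 s) (v2 s)" if "s \<in> I" for s
    unfolding \<epsilon>_def by (rule spacelike_framed_curve_pseudo_frame[OF curve that])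
  have \<mu>: "triple_product (\<gamma> s) (v1 s) (v2 s) = \<mu> s" for s
    by (simp add: \<mu>_def)
  note pin = pseudo_frame_pinner[OF fr, unfolded \<mu>]
  obtain D where D0: "\<And>s. s \<in> I \<Longrightarrow> D 0 s = (\<gamma> s, v1 s, v2 s)"
    and D1: "(D 0 has_vector_derivative D (Suc 0) t) (at t within I)"
    using curve t unfolding spacelike_framed_curve_def smooth_curve_on_def by metis
  \<comment> \<open>\<open>D 0\<close> is known to equal the curve only on \<open>I\<close>, which
    suffices for a derivative within \<open>I\<close>.\<close>
  have D: "((\<lambda>s. (\<gamma> s, v1 s, v2 s)) has_vector_derivative D (Suc 0) t) (at t within I)"
    by (rule has_vector_derivative_transform[OF t _ D1]) (simp add: D0)
  have "\<gamma> differentiable at t within I" "v1 differentiable at t within I"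
    "v2 differentiable at t within I"
    using bounded_linear.has_vector_derivative[OF bounded_linear_fst D]
      bounded_linear.has_vector_derivative[OF bounded_linear_fst
        bounded_linear.has_vector_derivative[OF bounded_linear_snd D]]
      bounded_linear.has_vector_derivative[OF bounded_linear_snd
        bounded_linear.has_vector_derivative[OF bounded_linear_snd D]]
    by (auto intro: differentiableI_vector)
  moreover from this have "\<mu> differentiable at t within I"
    unfolding \<mu>_def by (rule differentiable_triple_product)
  ultimately have d: "(\<gamma> has_vector_derivative deriv_on I \<gamma> t) (at t within I)"
    "(v1 has_vector_derivative deriv_on I v1 t) (at t within I)"
    "(v2 has_vector_derivative deriv_on I v2 t) (at t within I)"
    "(\<mu> has_vector_derivative deriv_on I \<mu> t) (at t within I)"
    by (simp_all add: vector_derivative_works)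
  note const = pinner_derivative_constant[OF _ t nontriv]
  \<comment> \<open>Differentiating the ten constant entries of the Gram matrix: four squared norms,
    then six mixed products.\<close>
  note skew =
    const[OF pin(2) d(1) d(1)] const[OF pin(3) d(2) d(2)] const[OF pin(4) d(3) d(3)]
    const[OF pin(11) d(4) d(4)] const[OF pin(6) d(2) d(1)] const[OF pin(8) d(3) d(1)]
    const[OF pin(10) d(3) d(2)] const[OF pin(13) d(4) d(1)] const[OF pin(15) d(4) d(2)]
    const[OF pin(17) d(4) d(3)]
  have orth: "pinner (deriv_on I \<gamma> t) (v1 t) = 0" "pinner (deriv_on I \<gamma> t) (v2 t) = 0"
    using curve t by (auto simp: spacelike_framed_curve_def)
  have c: "pinner (deriv_on I \<gamma> t) (\<mu> t) = \<alpha>" "l = - \<epsilon> * pinner (deriv_on I v1 t) (v2 t)"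
    "pinner (deriv_on I v1 t) (\<mu> t) = m" "pinner (deriv_on I v2 t) (\<mu> t) = n"
    using curv pin(3)[OF t] by (auto simp: framed_curvature_def Let_def \<mu>)
  have "pinner (deriv_on I v1 t) (v2 t) = - \<epsilon> * l"
    using c(2) pin(1)[OF t] by algebra
  note facts = this c(1,3,4) orth skew[unfolded pinner_commute[of "\<gamma> t"] pinner_commute[of "v1 t"]
      pinner_commute[of "v2 t"] pinner_commute[of "\<mu> t"]]
  note eqI = pseudo_frame_eqI[OF fr[OF t], unfolded \<mu>]
  have e: "deriv_on I \<gamma> t = \<alpha> *\<^sub>R \<mu> t" "deriv_on I v1 t = l *\<^sub>R v2 t + m *\<^sub>R \<mu> t"
    "deriv_on I v2 t = l *\<^sub>R v1 t + n *\<^sub>R \<mu> t"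
    "deriv_on I \<mu> t = \<alpha> *\<^sub>R \<gamma> t - (\<epsilon> * m) *\<^sub>R v1 t + (\<epsilon> * n) *\<^sub>R v2 t"
    using facts pin[OF t]
    by (intro eqI; simp add: pinner.add_left pinner.diff_left pinner.scaleR_left; fail)+
  show "(\<gamma> has_vector_derivative \<alpha> *\<^sub>R \<mu> t) (at t within I)"
    "(v1 has_vector_derivative l *\<^sub>R v2 t + m *\<^sub>R \<mu> t) (at t within I)"
    "(v2 has_vector_derivative l *\<^sub>R v1 t + n *\<^sub>R \<mu> t) (at t within I)"
    "(\<mu> has_vector_derivative \<alpha> *\<^sub>R \<gamma> t - (\<epsilon> * m) *\<^sub>R v1 t + (\<epsilon> * n) *\<^sub>R v2 t) (at t within I)"
    using d by (simp_all add: e)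
qed

section \<open>Constancy of the frame map and congruence\<close>

lemma frame_map_derivative_zero:
  assumes curve: "spacelike_framed_curve \<Delta> I \<gamma> v1 v2"
    and curve': "spacelike_framed_curve \<Delta> I \<gamma>t v1t v2t"
    and curv: "framed_curvature I \<gamma> v1 v2 t = framed_curvature I \<gamma>t v1t v2t t"
    and t: "t \<in> I" "at t within I \<noteq> bot"
  defines "\<epsilon> \<equiv> if \<Delta> = pseudo_orthogonal_pairs AdS3 S32 then -1 else 1 :: real"
  shows "((\<lambda>s. frame_map \<epsilon> (\<gamma> s) (v1 s) (v2 s) (\<gamma>t s) (v1t s) (v2t s) x)
    has_vector_derivative 0) (at t within I)"
proof -
  obtain \<alpha> l m n where c: "framed_curvature I \<gamma> v1 v2 t = (\<alpha>, l, m, n)"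
    by (cases "framed_curvature I \<gamma> v1 v2 t")
  note fr = frenet_equations[OF curve t c, folded \<epsilon>_def]
    frenet_equations[OF curve' t c[unfolded curv], folded \<epsilon>_def]
  have "\<epsilon> * \<epsilon> = 1" by (simp add: \<epsilon>_def)
  then have \<epsilon>: "\<epsilon> * (\<epsilon> * y) = y" for y
    by (simp flip: mult.assoc)
  note px = pinner.has_vector_derivative[OF has_vector_derivative_const]
  note sc = bounded_bilinear.has_vector_derivative[OF bounded_bilinear_scaleR]
  note em = bounded_linear.has_vector_derivative[OF bounded_linear_mult_right[of \<epsilon>]]
  \<comment> \<open>Facts 1 to 4 of \<open>fr\<close> concern the first frame, 5 to 8 the second.
    They are paired in the order of \<open>frame_map\<close>: \<mu>, \<gamma>, \<open>v1\<close>,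
    \<open>v2\<close>.\<close>
  note deriv = has_vector_derivative_diff[OF has_vector_derivative_add[OF has_vector_derivative_diff[OF
        sc[OF px[OF fr(4)] fr(8)] sc[OF px[OF fr(1)] fr(5)]]
        sc[OF em[OF px[OF fr(2)]] fr(6)]] sc[OF em[OF px[OF fr(3)]] fr(7)]]
  \<comment> \<open>Every product that arises does so twice with opposite signs:
    \<open>pinner x (v1 t) *\<^sub>R v2t t\<close>, for instance, gets \<epsilon> * l from the
    derivative of \<open>v1t\<close> and -\<epsilon> * l from that of \<open>v2\<close>.\<close>
  show ?thesis
    unfolding frame_map_def
    by (rule has_vector_derivative_eq_rhs[OF deriv])
      (simp add: pinner.add_right pinner.diff_right pinner.scaleR_right pinner.zero_left \<epsilon> algebra_simps)
qed

theorem theorem3p3: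
  fixes I :: "real set"
    and \<Delta> :: "((real^4) \<times> (real^4)) set"
    and \<gamma> v1 v2 \<gamma>t v1t v2t :: "real \<Rightarrow> real^4"
  assumes "is_interval I"
    and "spacelike_framed_curve \<Delta> I \<gamma> v1 v2"
    and "spacelike_framed_curve \<Delta> I \<gamma>t v1t v2t"
    and "\<forall>s\<in>I. framed_curvature I \<gamma> v1 v2 s = framed_curvature I \<gamma>t v1t v2t s"
  shows "\<exists>A\<in>SO22. \<forall>s\<in>I. \<gamma>t s = A *v \<gamma> s \<and> v1t s = A *v v1 s \<and> v2t s = A *v v2 s"
proof (cases "I = {}")
  case True
  have "mat 1 \<in> SO22"
    by (simp add: SO22_def)
  with True show ?thesis by auto
next
  case False
  then obtain a where a: "a \<in> I" by auto
  define \<epsilon> where "\<epsilon> = (if \<Delta> = pseudo_orthogonal_pairs AdS3 S32 then -1 else 1 :: real)"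
  define \<Phi> where "\<Phi> s = frame_map \<epsilon> (\<gamma> s) (v1 s) (v2 s) (\<gamma>t s) (v1t s) (v2t s)" for s
  have fr: "pseudo_frame \<epsilon> (\<gamma> s) (v1 s) (v2 s)" "pseudo_frame \<epsilon> (\<gamma>t s) (v1t s) (v2t s)"
    if "s \<in> I" for s
    unfolding \<epsilon>_def using spacelike_framed_curve_pseudo_frame assms(2,3) that by blast+
  have const: "\<Phi> s x = \<Phi> a x" if s: "s \<in> I" for s x
  proof (cases "s = a")
    case False
    \<comment> \<open>Two distinct points make every point of the interval a limit point. A
      one-point \<open>I\<close>, where derivatives within \<open>I\<close> are not unique, falls
      under the case \<open>s = a\<close>.\<close>
    have nontriv: "at t within I \<noteq> bot" if "t \<in> I" for t
    proof -
      have "I \<noteq> {y}" for y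
        using False a s by auto
      then show ?thesis
        using connected_imp_perfect[OF is_interval_connected[OF assms(1)] that]
        by (simp add: trivial_limit_within)
    qed
    have "((\<lambda>s. \<Phi> s x) has_vector_derivative 0) (at t within I)" if "t \<in> I" for t
      unfolding \<Phi>_def \<epsilon>_def
      using frame_map_derivative_zero[OF assms(2,3) _ that nontriv[OF that]] assms(4) that by blast
    then show ?thesis
      using has_vector_derivative_zero_constant[OF is_interval_convex[OF assms(1)]] a s by metis
  qed simp
  have "matrix (\<Phi> a) *v x = \<Phi> a x" for x
    by (simp add: \<Phi>_def linear_frame_map matrix_works)
  moreover have "matrix (\<Phi> a) \<in> SO22"
    unfolding \<Phi>_def by (rule matrix_frame_map_in_SO22[OF fr[OF a]])
  moreover have "\<Phi> s (\<gamma> s) = \<gamma>t s" "\<Phi> s (v1 s) = v1t s" "\<Phi> s (v2 s) = v2t s" if "s \<in> I" for s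
    unfolding \<Phi>_def by (rule frame_map_frame[OF fr(1)[OF that]])+
  ultimately show ?thesis
    using const by (intro bexI[of _ "matrix (\<Phi> a)"]) auto
qed

end
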